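(* The number of iterations in Algorithm 1 is at most \[O\Big(\frac{\log^2(m)\log(\eta\max_t|B^{(t)}|/\varepsilon)}{\varepsilon^4}\Big).\]
   Context: Let $A\in\mathbb{R}^{m\times N}_{\ge0}$ be a nonnegative matrix with no zero column and $\varepsilon>0$. Algorithm 1 (Parallel MWU): set $\eta=\ln(m)/\varepsilon$, $x=\mathbf 0_N$, $w=\mathbf 1_m$, $\lambda=\min_j(A^\top w)_j$, $y=w/\lambda$. While $\|Ax\|_\infty<\eta$, perform one iteration: (i) if $\min_j(A^\top w)_j<(1+\varepsilon)\lambda$, let $B=\{j:(A^\top w)_j<(1+\varepsilon)\lambda\}$ and $B_0=\{j\in B:x_j=0\}$; if $B_0\ne\emptyset$ set $g_j=\varepsilon/(|B_0|\max_iA_{ij})$ for $j\in B_0$ and $g_j=0$ otherwise; else set $g_j=\delta x_j$ for $j\in B$ and $g_j=0$ otherwise, with $\delta>0$ chosen so that $\|Ag\|_\infty=\varepsilon$; then $x\gets x+g$ and $w\gets w\circ(\mathbf 1+Ag)$ (entrywise product). (ii) Otherwise set $\lambda\gets(1+\varepsilon)\lambda$, and if $\langle\mathbf 1,w\rangle/\lambda<\langle\mathbf 1,y\rangle$ set $y\gets w/\lambda$. Output $(x/\|Ax\|_\infty,y)$. For iteration $t$, $B^{(t)}=\{j:(A^\top w^{(t)})_j<(1+\varepsilon)\lambda^{(t)}\}$, where $w^{(t)},\lambda^{(t)}$ are the values of $w,\lambda$ at the start of iteration $t$.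
   Formalization: The bound is proved for ε ≤ E and η·max_t|B^(t)|/ε ≥ c, with arbitrary constants E > 0, c > 1 on which alone the O-constant depends; without this it fails (m=2, N=1, ε=1 makes the logarithm negative). Termination is proved for all ε > 0. *)

theory Defs
  imports Complex_Main "Jordan_Normal_Form.Matrix"
begin

text \<open>
  Vectors and matrices are those of \<^theory>\<open>Jordan_Normal_Form.Matrix\<close>, whose dimensions are
  terms rather than types, so that one constant can be uniform in both dimensions.
\<close>

definition linf_norm :: "real vec \<Rightarrow> real" where
  "linf_norm v = Max (abs ` set\<^sub>v v)"

definition ones :: "nat \<Rightarrow> real vec" where
  "ones n = vec n (\<lambda>_. 1)"

record mwu_state =
  xv :: "real vec"
  wv :: "real vec"
  lam :: real
  yv :: "real vec"

definition mwu_eta :: "real mat \<Rightarrow> real \<Rightarrow> real" where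
  "mwu_eta A \<epsilon> = ln (real (dim_row A)) / \<epsilon>"

definition mwu_init :: "real mat \<Rightarrow> mwu_state" where
  "mwu_init A =
    (let w = ones (dim_row A);
         l = Min (set\<^sub>v (A\<^sup>T *\<^sub>v w))
     in \<lparr>xv = 0\<^sub>v (dim_col A), wv = w, lam = l, yv = (1 / l) \<cdot>\<^sub>v w\<rparr>)"

definition mwu_B :: "real mat \<Rightarrow> real \<Rightarrow> mwu_state \<Rightarrow> nat set" where
  "mwu_B A \<epsilon> s = {j. j < dim_col A \<and> (A\<^sup>T *\<^sub>v wv s) $ j < (1 + \<epsilon>) * lam s}"

definition mwu_B0 :: "real mat \<Rightarrow> real \<Rightarrow> mwu_state \<Rightarrow> nat set" where
  "mwu_B0 A \<epsilon> s = {j \<in> mwu_B A \<epsilon> s. xv s $ j = 0}"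

definition mwu_init_dir :: "real mat \<Rightarrow> real \<Rightarrow> mwu_state \<Rightarrow> real vec" where
  "mwu_init_dir A \<epsilon> s =
    vec (dim_col A) (\<lambda>j. if j \<in> mwu_B0 A \<epsilon> s
      then \<epsilon> / (real (card (mwu_B0 A \<epsilon> s)) * Max (set\<^sub>v (col A j))) else 0)"

definition mwu_scale_dir :: "real mat \<Rightarrow> real \<Rightarrow> mwu_state \<Rightarrow> real \<Rightarrow> real vec" where
  "mwu_scale_dir A \<epsilon> s \<delta> =
    vec (dim_col A) (\<lambda>j. if j \<in> mwu_B A \<epsilon> s then \<delta> * xv s $ j else 0)"

text \<open>
  The sup norm of \<^term>\<open>A *\<^sub>v mwu_scale_dir A \<epsilon> s \<delta>\<close> is positively homogeneous in \<open>\<delta>\<close>. When this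
  direction is used in a run, \<open>A\<close> is nonnegative without zero columns, \<^term>\<open>mwu_B A \<epsilon> s\<close> is
  nonempty and \<^term>\<open>xv s\<close> is positive on it, so exactly one \<open>\<delta>\<close> qualifies below.
\<close>

definition mwu_delta :: "real mat \<Rightarrow> real \<Rightarrow> mwu_state \<Rightarrow> real" where
  "mwu_delta A \<epsilon> s =
    (SOME \<delta>. \<delta> > 0 \<and> linf_norm (A *\<^sub>v mwu_scale_dir A \<epsilon> s \<delta>) = \<epsilon>)"

definition mwu_dir :: "real mat \<Rightarrow> real \<Rightarrow> mwu_state \<Rightarrow> real vec" where
  "mwu_dir A \<epsilon> s =
    (if mwu_B0 A \<epsilon> s \<noteq> {} then mwu_init_dir A \<epsilon> s
     else mwu_scale_dir A \<epsilon> s (mwu_delta A \<epsilon> s))"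

definition mwu_step :: "real mat \<Rightarrow> real \<Rightarrow> mwu_state \<Rightarrow> mwu_state" where
  "mwu_step A \<epsilon> s =
    (if Min (set\<^sub>v (A\<^sup>T *\<^sub>v wv s)) < (1 + \<epsilon>) * lam s
     then (let g = mwu_dir A \<epsilon> s
           in s\<lparr>xv := xv s + g,
                wv := vec (dim_row A) (\<lambda>i. wv s $ i * (1 + (A *\<^sub>v g) $ i))\<rparr>)
     else (let l = (1 + \<epsilon>) * lam s
           in s\<lparr>lam := l,
                yv := (if (ones (dim_row A) \<bullet> wv s) / l < ones (dim_row A) \<bullet> yv s
                       then (1 / l) \<cdot>\<^sub>v wv s else yv s)\<rparr>))"

definition mwu_running :: "real mat \<Rightarrow> real \<Rightarrow> mwu_state \<Rightarrow> bool" where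
  "mwu_running A \<epsilon> s \<longleftrightarrow> linf_norm (A *\<^sub>v xv s) < mwu_eta A \<epsilon>"

text \<open>The state at the start of iteration \<open>t\<close>, counting iterations from \<open>0\<close>.\<close>

definition mwu_at :: "real mat \<Rightarrow> real \<Rightarrow> nat \<Rightarrow> mwu_state" where
  "mwu_at A \<epsilon> t = (mwu_step A \<epsilon> ^^ t) (mwu_init A)"

definition mwu_iterations :: "real mat \<Rightarrow> real \<Rightarrow> nat \<Rightarrow> bool" where
  "mwu_iterations A \<epsilon> T \<longleftrightarrow>
    (\<forall>t<T. mwu_running A \<epsilon> (mwu_at A \<epsilon> t)) \<and> \<not> mwu_running A \<epsilon> (mwu_at A \<epsilon> T)"

text \<open>\<open>max\<^sub>t |B\<^sup>(\<^sup>t\<^sup>)|\<close> over the first \<open>T\<close> iterations; meaningful for \<open>T > 0\<close> only.\<close>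

definition mwu_max_B :: "real mat \<Rightarrow> real \<Rightarrow> nat \<Rightarrow> nat" where
  "mwu_max_B A \<epsilon> T = Max ((\<lambda>t. card (mwu_B A \<epsilon> (mwu_at A \<epsilon> t))) ` {..<T})"

end

theory Submission
  imports Defs
begin

text \<open>
  Call the iterations between two consecutive increases of \<open>\<lambda>\<close> a phase. Two estimates are multiplied.

  Number of phases: \<open>\<lambda> \<le> (A\<^sup>T w)\<^sub>j\<close> holds throughout, and \<open>w\<^sub>i \<le> exp (A x)\<^sub>i < exp \<eta>\<close> while the loop
  runs; comparing at the column that attains the initial \<open>\<lambda>\<close> gives \<open>(1 + \<epsilon>)\<^sup>K \<le> exp \<eta>\<close> after \<open>K\<close>
  increases.

  Length of a phase: within a phase \<open>w\<close> grows and \<open>\<lambda>\<close> is fixed, so \<open>B\<close> shrinks. After the first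
  iteration every \<open>j \<in> B\<close> has \<open>x\<^sub>j \<ge> \<epsilon> / (M max\<^sub>i A\<^sub>i\<^sub>j)\<close>, where \<open>M\<close> bounds the sizes of the sets \<open>B\<close>,
  and from then on each iteration multiplies \<open>x\<^sub>j\<close> by \<open>1 + \<delta> \<ge> 1 + \<epsilon> / \<eta>\<close>, because
  \<open>\<epsilon> = \<parallel>A g\<parallel> \<le> \<delta> \<parallel>A x\<parallel> \<le> \<delta> \<eta>\<close>. As \<open>x\<^sub>j max\<^sub>i A\<^sub>i\<^sub>j \<le> \<parallel>A x\<parallel> < \<eta>\<close>, there are at most
  \<open>2 + ln (\<eta> M / \<epsilon>) / ln (1 + \<epsilon> / \<eta>)\<close> iterations before \<open>\<lambda>\<close> increases.

  Taking \<open>M\<close> at least the number of columns shows that the loop terminates; the sharper bound then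
  comes from \<open>M = max\<^sub>t |B\<^sup>(\<^sup>t\<^sup>)|\<close>.
\<close>

section \<open>Sup norm of vectors\<close>

lemma finite_vec_set: "finite (set\<^sub>v v)"
  by (simp add: vec_set_def)

lemma vec_set_nonempty: "0 < dim_vec v \<Longrightarrow> set\<^sub>v v \<noteq> {}"
  by (auto simp: vec_set_def)

lemma abs_index_le_linf_norm: "i < dim_vec v \<Longrightarrow> \<bar>v $ i\<bar> \<le> linf_norm v"
  unfolding linf_norm_def by (rule Max_ge) (auto simp: vec_set_def)

lemma linf_norm_attained:
  assumes "0 < dim_vec v"
  obtains i where "i < dim_vec v" "linf_norm v = \<bar>v $ i\<bar>"
proof -
  have "linf_norm v \<in> abs ` set\<^sub>v v"
    unfolding linf_norm_def using assms
    by (intro Max_in) (auto simp: finite_vec_set vec_set_nonempty)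
  then show thesis
    using that by (auto elim!: vec_setE)
qed

lemma linf_norm_nonneg: "0 < dim_vec v \<Longrightarrow> 0 \<le> linf_norm v"
  by (rule order.trans[OF abs_ge_zero abs_index_le_linf_norm])

lemma linf_norm_le:
  assumes "0 < dim_vec v" and "\<And>i. i < dim_vec v \<Longrightarrow> \<bar>v $ i\<bar> \<le> b"
  shows "linf_norm v \<le> b"
  using linf_norm_attained[OF assms(1)] assms(2) by metis

lemma linf_norm_smult:
  assumes "0 < dim_vec v" and "0 \<le> a"
  shows "linf_norm (a \<cdot>\<^sub>v v) = a * linf_norm v"
proof (rule antisym)
  show "linf_norm (a \<cdot>\<^sub>v v) \<le> a * linf_norm v"
    using assms by (intro linf_norm_le)
      (auto simp: abs_mult intro!: mult_left_mono abs_index_le_linf_norm)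
  obtain i where i: "i < dim_vec v" "linf_norm v = \<bar>v $ i\<bar>"
    using linf_norm_attained[OF assms(1)] by blast
  then have "a * linf_norm v = \<bar>(a \<cdot>\<^sub>v v) $ i\<bar>"
    using assms(2) by (simp add: abs_mult)
  also have "\<dots> \<le> linf_norm (a \<cdot>\<^sub>v v)"
    using i by (intro abs_index_le_linf_norm) simp
  finally show "a * linf_norm v \<le> linf_norm (a \<cdot>\<^sub>v v)" .
qed

section \<open>Logarithm estimates\<close>

text \<open>Comes from \<open>ln u \<le> u - 1\<close> at \<open>u = 1 / (1 + z)\<close>. It holds
  for every positive \<open>z\<close> and is used for both \<open>z = \<epsilon>\<close> and
  \<open>z = \<epsilon> / \<eta>\<close>.\<close>

lemma inverse_ln_one_plus_le:
  fixes z :: real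
  assumes "0 < z"
  shows "1 / ln (1 + z) \<le> 1 + 1 / z"
proof -
  have "- ln (1 + z) = ln (1 / (1 + z))"
    using assms by (simp add: ln_div)
  also have "\<dots> \<le> 1 / (1 + z) - 1"
    using assms by (intro ln_le_minus_one) simp
  finally have "z / (1 + z) \<le> ln (1 + z)"
    using assms by (simp add: field_simps)
  then have "1 / ln (1 + z) \<le> 1 / (z / (1 + z))"
    using assms by (intro divide_left_mono) auto
  then show ?thesis
    using assms by (simp add: field_simps)
qed

lemma exponent_le_ln_quotient:
  fixes a b :: real
  assumes "1 < a" and "a ^ n \<le> b"
  shows "real n \<le> ln b / ln a"
proof -
  have "real n * ln a = ln (a ^ n)"
    using assms(1) by (simp add: ln_realpow)
  also have "\<dots> \<le> ln b"
    using assms by (intro ln_mono) (auto intro: less_le_trans)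
  finally show ?thesis
    using assms(1) by (simp add: field_simps)
qed

section \<open>Nonnegative matrices without zero columns\<close>

locale mwu =
  fixes m N :: nat and A :: "real mat" and \<epsilon> :: real
  assumes m_pos: "0 < m" and N_pos: "0 < N"
    and A_carrier: "A \<in> carrier_mat m N"
    and A_nonneg: "i < m \<Longrightarrow> j < N \<Longrightarrow> 0 \<le> A $$ (i, j)"
    and col_nonzero: "j < N \<Longrightarrow> col A j \<noteq> 0\<^sub>v m"
    and eps_pos: "0 < \<epsilon>"
begin

abbreviation "\<eta> \<equiv> mwu_eta A \<epsilon>"
abbreviation "colmax j \<equiv> Max (set\<^sub>v (col A j))"
abbreviation "lam0 \<equiv> lam (mwu_init A)"

lemma dims [simp]: "dim_row A = m" "dim_col A = N"
  using A_carrier by auto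

lemma mult_vec_index:
  "i < m \<Longrightarrow> dim_vec x = N \<Longrightarrow> (A *\<^sub>v x) $ i = (\<Sum>j<N. A $$ (i, j) * x $ j)"
  by (auto simp: scalar_prod_def atLeast0LessThan intro!: sum.cong)

lemma transpose_mult_vec_index:
  "j < N \<Longrightarrow> dim_vec w = m \<Longrightarrow> (A\<^sup>T *\<^sub>v w) $ j = (\<Sum>i<m. A $$ (i, j) * w $ i)"
  by (auto simp: scalar_prod_def atLeast0LessThan intro!: sum.cong)

lemma colmax_attained:
  assumes "j < N"
  obtains i where "i < m" "colmax j = A $$ (i, j)"
proof -
  have "colmax j \<in> set\<^sub>v (col A j)"
    by (intro Max_in) (auto simp: finite_vec_set vec_set_nonempty m_pos)
  then show thesis
    using that assms by (auto elim!: vec_setE)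
qed

lemma nonzero_entry:
  assumes "j < N"
  obtains i where "i < m" "0 < A $$ (i, j)"
proof -
  have "\<exists>i<m. A $$ (i, j) \<noteq> 0"
  proof (rule ccontr)
    assume "\<not> ?thesis"
    then have "col A j = 0\<^sub>v m"
      using assms by (intro eq_vecI) auto
    then show False
      using col_nonzero assms by blast
  qed
  then show thesis
    using that A_nonneg assms by (metis less_eq_real_def)
qed

lemma colmax_pos:
  assumes "j < N"
  shows "0 < colmax j"
proof -
  obtain i where i: "i < m" "0 < A $$ (i, j)"
    using nonzero_entry[OF assms] by blast
  have "A $$ (i, j) \<le> colmax j"
    using i(1) assms by (intro Max_ge finite_vec_set vec_setI) auto
  with i(2) show ?thesis by simp
qed

lemma mult_vec_mono:
  assumes "i < m" "dim_vec x = N" "dim_vec y = N" "\<And>j. j < N \<Longrightarrow> x $ j \<le> y $ j"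
  shows "(A *\<^sub>v x) $ i \<le> (A *\<^sub>v y) $ i"
  unfolding mult_vec_index[OF assms(1,2)] mult_vec_index[OF assms(1,3)]
  using assms by (intro sum_mono mult_left_mono A_nonneg) auto

lemma mult_vec_nonneg:
  assumes "i < m" "dim_vec x = N" "\<And>j. j < N \<Longrightarrow> 0 \<le> x $ j"
  shows "0 \<le> (A *\<^sub>v x) $ i"
  unfolding mult_vec_index[OF assms(1,2)]
  using assms by (intro sum_nonneg mult_nonneg_nonneg A_nonneg) auto

lemma colmax_mult_le_linf_norm:
  assumes "dim_vec x = N" "\<And>j. j < N \<Longrightarrow> 0 \<le> x $ j" "j < N"
  shows "colmax j * x $ j \<le> linf_norm (A *\<^sub>v x)"
proof -
  obtain i where i: "i < m" "colmax j = A $$ (i, j)"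
    using colmax_attained[OF assms(3)] by blast
  have "colmax j * x $ j \<le> (\<Sum>j<N. A $$ (i, j) * x $ j)"
    unfolding i(2) using assms i A_nonneg
    by (intro member_le_sum[where f = "\<lambda>j. A $$ (i, j) * x $ j"]) auto
  also have "\<dots> = (A *\<^sub>v x) $ i"
    using mult_vec_index i(1) assms(1) by simp
  also have "\<dots> \<le> linf_norm (A *\<^sub>v x)"
    using i by (intro order.trans[OF abs_ge_self abs_index_le_linf_norm]) simp
  finally show ?thesis .
qed

lemma Min_transpose_mult_le:
  "j < N \<Longrightarrow> Min (set\<^sub>v (A\<^sup>T *\<^sub>v w)) \<le> (A\<^sup>T *\<^sub>v w) $ j"
  by (intro Min_le finite_vec_set vec_setI) auto

lemma Min_transpose_mult_attained:
  obtains j where "j < N" "Min (set\<^sub>v (A\<^sup>T *\<^sub>v w)) = (A\<^sup>T *\<^sub>v w) $ j"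
proof -
  have "Min (set\<^sub>v (A\<^sup>T *\<^sub>v w)) \<in> set\<^sub>v (A\<^sup>T *\<^sub>v w)"
    by (intro Min_in) (auto simp: finite_vec_set vec_set_nonempty N_pos)
  then obtain j where "j < dim_vec (A\<^sup>T *\<^sub>v w)" "(A\<^sup>T *\<^sub>v w) $ j = Min (set\<^sub>v (A\<^sup>T *\<^sub>v w))"
    by (metis vec_setE)
  then show thesis
    using that[of j] by simp
qed

text \<open>Ties the branch test of \<open>mwu_step\<close> to \<open>B\<close>, so that the
  invariant can be treated by cases on whether \<open>B\<close> is empty.\<close>

lemma B_nonempty_iff:
  "mwu_B A \<epsilon> s \<noteq> {} \<longleftrightarrow> Min (set\<^sub>v (A\<^sup>T *\<^sub>v wv s)) < (1 + \<epsilon>) * lam s"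
proof
  assume "mwu_B A \<epsilon> s \<noteq> {}"
  then obtain j where "j < N" "(A\<^sup>T *\<^sub>v wv s) $ j < (1 + \<epsilon>) * lam s"
    by (auto simp: mwu_B_def)
  then show "Min (set\<^sub>v (A\<^sup>T *\<^sub>v wv s)) < (1 + \<epsilon>) * lam s"
    using Min_transpose_mult_le[of j "wv s"] by linarith
next
  assume "Min (set\<^sub>v (A\<^sup>T *\<^sub>v wv s)) < (1 + \<epsilon>) * lam s"
  moreover obtain j where "j < N" "Min (set\<^sub>v (A\<^sup>T *\<^sub>v wv s)) = (A\<^sup>T *\<^sub>v wv s) $ j"
    using Min_transpose_mult_attained by blast
  ultimately show "mwu_B A \<epsilon> s \<noteq> {}"
    unfolding mwu_B_def by auto
qed

lemma finite_B: "finite (mwu_B A \<epsilon> s)"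
  by (rule finite_subset[of _ "{..<N}"]) (auto simp: mwu_B_def)

lemma card_B_le: "card (mwu_B A \<epsilon> s) \<le> N"
  using card_mono[of "{..<N}" "mwu_B A \<epsilon> s"] by (auto simp: mwu_B_def)

section \<open>Lower bounds on the step direction\<close>

text \<open>For scale 1 the direction is \<open>x\<close> restricted to \<open>B\<close>, so its
  image under \<open>A\<close> has norm below \<eta>. By homogeneity, the chosen scale times that
  norm equals \<epsilon>.\<close>

lemma delta_ge:
  assumes dim: "dim_vec (xv s) = N" and nn: "\<And>j. j < N \<Longrightarrow> 0 \<le> xv s $ j"
    and ne: "mwu_B A \<epsilon> s \<noteq> {}" and B0: "mwu_B0 A \<epsilon> s = {}"
    and run: "mwu_running A \<epsilon> s"
  shows "\<epsilon> / \<eta> \<le> mwu_delta A \<epsilon> s"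
proof -
  let ?d = "mwu_scale_dir A \<epsilon> s"
  have dim1: "dim_vec (?d \<delta>) = N" for \<delta>
    by (simp add: mwu_scale_dir_def)
  have nn1: "0 \<le> ?d 1 $ j" if "j < N" for j
    using nn that by (auto simp: mwu_scale_dir_def)
  have le1: "?d 1 $ j \<le> xv s $ j" if "j < N" for j
    using nn that by (auto simp: mwu_scale_dir_def)
  have scale: "?d \<delta> = \<delta> \<cdot>\<^sub>v ?d 1" for \<delta>
    by (intro eq_vecI) (auto simp: mwu_scale_dir_def)
  have "A *\<^sub>v (\<delta> \<cdot>\<^sub>v ?d 1) = \<delta> \<cdot>\<^sub>v (A *\<^sub>v ?d 1)" for \<delta>
    by (rule mult_mat_vec[OF A_carrier carrier_vecI[OF dim1]])
  then have norm: "linf_norm (A *\<^sub>v ?d \<delta>) = \<delta> * linf_norm (A *\<^sub>v ?d 1)" if "0 \<le> \<delta>" for \<delta>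
    using linf_norm_smult[of "A *\<^sub>v ?d 1" \<delta>] that m_pos by (subst scale) simp
  obtain j where j: "j \<in> mwu_B A \<epsilon> s" "j < N" "xv s $ j \<noteq> 0"
    using ne B0 by (auto simp: mwu_B_def mwu_B0_def)
  have "0 < xv s $ j"
    using j nn[of j] by linarith
  then have "0 < colmax j * ?d 1 $ j"
    using j colmax_pos by (simp add: mwu_scale_dir_def)
  also have "\<dots> \<le> linf_norm (A *\<^sub>v ?d 1)"
    using colmax_mult_le_linf_norm[OF dim1 nn1 j(2)] .
  finally have pos: "0 < linf_norm (A *\<^sub>v ?d 1)" .
  \<comment> \<open>The \<open>SOME\<close> in \<open>mwu_delta\<close> says nothing without a
    witness; homogeneity provides \<epsilon> divided by the norm at scale 1.\<close>
  have "\<exists>\<delta>>0. linf_norm (A *\<^sub>v ?d \<delta>) = \<epsilon>"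
    using pos eps_pos norm[of "\<epsilon> / linf_norm (A *\<^sub>v ?d 1)"]
    by (intro exI[of _ "\<epsilon> / linf_norm (A *\<^sub>v ?d 1)"]) simp
  then have delta: "0 < mwu_delta A \<epsilon> s" "linf_norm (A *\<^sub>v ?d (mwu_delta A \<epsilon> s)) = \<epsilon>"
    unfolding mwu_delta_def by (metis (mono_tags, lifting) someI_ex)+
  have "linf_norm (A *\<^sub>v ?d 1) \<le> linf_norm (A *\<^sub>v xv s)"
  proof (rule linf_norm_le)
    fix i assume "i < dim_vec (A *\<^sub>v ?d 1)"
    then have i: "i < m" by simp
    have "\<bar>(A *\<^sub>v ?d 1) $ i\<bar> = (A *\<^sub>v ?d 1) $ i"
      using mult_vec_nonneg[OF i dim1 nn1] by simp
    also have "\<dots> \<le> (A *\<^sub>v xv s) $ i"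
      by (rule mult_vec_mono[OF i dim1 dim le1])
    also have "\<dots> \<le> linf_norm (A *\<^sub>v xv s)"
      using i by (intro order.trans[OF abs_ge_self abs_index_le_linf_norm]) simp
    finally show "\<bar>(A *\<^sub>v ?d 1) $ i\<bar> \<le> linf_norm (A *\<^sub>v xv s)" .
  qed (simp add: m_pos)
  also have "\<dots> < \<eta>"
    using run by (simp add: mwu_running_def)
  finally have lt: "linf_norm (A *\<^sub>v ?d 1) < \<eta>" .
  have "\<epsilon> = mwu_delta A \<epsilon> s * linf_norm (A *\<^sub>v ?d 1)"
    using delta norm[of "mwu_delta A \<epsilon> s"] by simp
  also have "\<dots> \<le> mwu_delta A \<epsilon> s * \<eta>"
    using delta lt by simp
  finally show ?thesis
    using pos lt by (simp add: field_simps)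
qed

lemma dim_dir: "dim_vec (mwu_dir A \<epsilon> s) = N"
  by (simp add: mwu_dir_def mwu_init_dir_def mwu_scale_dir_def)

text \<open>The amount \<epsilon> is shared among the columns of \<open>B0\<close> only, and
  \<open>B0\<close> lies in \<open>B\<close>, which has at most \<open>M\<close> elements.\<close>

lemma dir_ge_of_B0:
  assumes "j \<in> mwu_B0 A \<epsilon> s" and "real (card (mwu_B A \<epsilon> s)) \<le> M"
  shows "\<epsilon> / (M * colmax j) \<le> mwu_dir A \<epsilon> s $ j"
proof -
  have j: "j < N" and ne: "mwu_B0 A \<epsilon> s \<noteq> {}"
    using assms(1) by (auto simp: mwu_B0_def mwu_B_def)
  have sub: "mwu_B0 A \<epsilon> s \<subseteq> mwu_B A \<epsilon> s"
    by (auto simp: mwu_B0_def)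
  have pos: "0 < card (mwu_B0 A \<epsilon> s)"
    using ne sub finite_B by (simp add: card_gt_0_iff finite_subset)
  have "real (card (mwu_B0 A \<epsilon> s)) \<le> M"
    using card_mono[OF finite_B sub] assms(2) by linarith
  then have "\<epsilon> / (M * colmax j) \<le> \<epsilon> / (real (card (mwu_B0 A \<epsilon> s)) * colmax j)"
    using pos colmax_pos[OF j] eps_pos
    by (intro divide_left_mono mult_right_mono mult_pos_pos) auto
  then show ?thesis
    using assms(1) j ne by (simp add: mwu_dir_def mwu_init_dir_def)
qed

lemma dir_ge_of_B:
  assumes "dim_vec (xv s) = N" "\<And>j. j < N \<Longrightarrow> 0 \<le> xv s $ j"
    and "mwu_B0 A \<epsilon> s = {}" "mwu_running A \<epsilon> s" "j \<in> mwu_B A \<epsilon> s"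
  shows "\<epsilon> / \<eta> * xv s $ j \<le> mwu_dir A \<epsilon> s $ j"
proof -
  have j: "j < N" using assms(5) by (simp add: mwu_B_def)
  have "\<epsilon> / \<eta> \<le> mwu_delta A \<epsilon> s"
    using assms by (intro delta_ge) auto
  then have "\<epsilon> / \<eta> * xv s $ j \<le> mwu_delta A \<epsilon> s * xv s $ j"
    using assms(2)[OF j] by (rule mult_right_mono)
  then show ?thesis
    using assms j by (simp add: mwu_dir_def mwu_scale_dir_def)
qed

lemma eta_pos_of_running: "mwu_running A \<epsilon> s \<Longrightarrow> 0 < \<eta>"
  using linf_norm_nonneg[of "A *\<^sub>v xv s"] m_pos by (simp add: mwu_running_def)

lemma dir_nonneg:
  assumes "dim_vec (xv s) = N" "\<And>j. j < N \<Longrightarrow> 0 \<le> xv s $ j"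
    and "mwu_running A \<epsilon> s" "j < N"
  shows "0 \<le> mwu_dir A \<epsilon> s $ j"
proof (cases "mwu_B0 A \<epsilon> s = {}")
  case True
  show ?thesis
  proof (cases "j \<in> mwu_B A \<epsilon> s")
    case B: True
    have "0 \<le> \<epsilon> / \<eta> * xv s $ j"
      using eps_pos eta_pos_of_running[OF assms(3)] assms(2)[OF assms(4)] by simp
    then show ?thesis
      using dir_ge_of_B[OF assms(1,2) True assms(3) B] by linarith
  next
    case False
    then show ?thesis
      using True assms(4) by (simp add: mwu_dir_def mwu_scale_dir_def)
  qed
next
  case False
  then show ?thesis
    using assms(4) eps_pos colmax_pos[OF assms(4)] by (simp add: mwu_dir_def mwu_init_dir_def)
qed

section \<open>The invariant and its preservation\<close>

text \<open>
  \<open>K\<close> counts the increases of \<open>\<lambda>\<close> so far, \<open>s\<close> the iterations since the last of them, and \<open>Q\<close> is the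
  claimed bound on \<open>s\<close>.
\<close>

definition mwu_inv :: "real \<Rightarrow> real \<Rightarrow> nat \<Rightarrow> nat \<Rightarrow> nat \<Rightarrow> mwu_state \<Rightarrow> bool" where
  "mwu_inv M Q t K s st \<longleftrightarrow>
    dim_vec (xv st) = N \<and> dim_vec (wv st) = m \<and>
    (\<forall>i<m. 0 < wv st $ i \<and> wv st $ i \<le> exp ((A *\<^sub>v xv st) $ i)) \<and>
    lam st = (1 + \<epsilon>) ^ K * lam0 \<and>
    (\<forall>j<N. lam st \<le> (A\<^sup>T *\<^sub>v wv st) $ j) \<and>
    (\<forall>j<N. xv st $ j = 0 \<or> \<epsilon> / (M * colmax j) \<le> xv st $ j) \<and>
    real s \<le> Q \<and> real t \<le> real K * (Q + 1) + real s \<and>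
    (0 < s \<longrightarrow> (\<forall>j\<in>mwu_B A \<epsilon> st. \<epsilon> / (M * colmax j) * (1 + \<epsilon> / \<eta>) ^ (s - 1) \<le> xv st $ j))"

lemma lam0_eq: "lam0 = Min (set\<^sub>v (A\<^sup>T *\<^sub>v ones m))"
  by (simp add: mwu_init_def Let_def)

text \<open>The minimizing column has a positive entry. Positivity lets
  \<open>phase_count_bound\<close> cancel \<open>lam0\<close>.\<close>

lemma lam0_pos: "0 < lam0"
proof -
  obtain j where j: "j < N" "lam0 = (A\<^sup>T *\<^sub>v ones m) $ j"
    using Min_transpose_mult_attained lam0_eq by metis
  obtain i where i: "i < m" "0 < A $$ (i, j)"
    using nonzero_entry[OF j(1)] by blast
  have "(A\<^sup>T *\<^sub>v ones m) $ j = (\<Sum>i<m. A $$ (i, j))"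
    using j by (subst transpose_mult_vec_index) (auto simp: ones_def)
  also have "0 < \<dots>"
    using i j A_nonneg by (intro sum_pos2[of _ i]) auto
  finally show ?thesis using j by simp
qed

lemma mwu_inv_init:
  assumes "0 \<le> Q"
  shows "mwu_inv M Q 0 0 0 (mwu_init A)"
proof -
  have "(A *\<^sub>v 0\<^sub>v N) $ i = 0" if "i < m" for i
    using that by (subst mult_vec_index) auto
  moreover have "lam0 \<le> (A\<^sup>T *\<^sub>v ones m) $ j" if "j < N" for j
    unfolding lam0_eq using that by (rule Min_transpose_mult_le)
  ultimately show ?thesis
    using assms unfolding mwu_inv_def
    by (auto simp: mwu_init_def Let_def ones_def simp del: index_mult_mat_vec)
qed

lemma mwu_inv_x_nonneg:
  assumes "mwu_inv M Q t K s st" "0 < M" "j < N"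
  shows "0 \<le> xv st $ j"
proof -
  have "0 < \<epsilon> / (M * colmax j)"
    using eps_pos assms colmax_pos by simp
  then show ?thesis
    using assms(1,3) unfolding mwu_inv_def by fastforce
qed

text \<open>An empty \<open>B\<close> means that every entry of
  \<open>A\<^sup>T *\<^sub>v wv st\<close> already reaches the raised \<lambda>. The at most
  \<open>Q\<close> iterations of the phase and this one together are paid for by the
  \<open>Q + 1\<close> of the new \<open>K\<close>; at \<open>s = 0\<close> the growth clause is
  vacuous.\<close>

lemma mwu_inv_lambda_step:
  assumes inv: "mwu_inv M Q t K s st" and B: "mwu_B A \<epsilon> st = {}"
  shows "mwu_inv M Q (Suc t) (Suc K) 0 (mwu_step A \<epsilon> st)"
proof -
  have min: "\<not> Min (set\<^sub>v (A\<^sup>T *\<^sub>v wv st)) < (1 + \<epsilon>) * lam st"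
    using B B_nonempty_iff by blast
  have "(1 + \<epsilon>) * lam st \<le> (A\<^sup>T *\<^sub>v wv st) $ j" if "j < N" for j
    using min Min_transpose_mult_le[OF that, of "wv st"] by linarith
  moreover have "0 \<le> Q" "real (Suc t) \<le> real (Suc K) * (Q + 1)"
    using inv by (auto simp: mwu_inv_def algebra_simps)
  ultimately show ?thesis
    using inv min unfolding mwu_inv_def mwu_step_def Let_def
    by (simp del: index_mult_mat_vec)
qed

text \<open>At any column of \<open>B\<close> the geometric lower bound on \<open>x\<close> meets
  the bound \<eta> on the norm; multiplying by \<open>colmax j\<close> removes the dependence on
  \<open>j\<close>.\<close>

lemma phase_length_bound:
  assumes inv: "mwu_inv M Q t K s st" and M: "0 < M" and run: "mwu_running A \<epsilon> st"
    and B: "mwu_B A \<epsilon> st \<noteq> {}" and s: "0 < s"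
  shows "real (s - 1) \<le> ln (\<eta> * M / \<epsilon>) / ln (1 + \<epsilon> / \<eta>)"
proof (rule exponent_le_ln_quotient)
  have eta: "0 < \<eta>" using eta_pos_of_running[OF run] .
  then show "1 < 1 + \<epsilon> / \<eta>" using eps_pos by simp
  obtain j where j: "j \<in> mwu_B A \<epsilon> st" "j < N"
    using B by (auto simp: mwu_B_def)
  have cm: "0 < colmax j" using colmax_pos[OF j(2)] .
  have "\<epsilon> / M * (1 + \<epsilon> / \<eta>) ^ (s - 1) = colmax j * (\<epsilon> / (M * colmax j) * (1 + \<epsilon> / \<eta>) ^ (s - 1))"
    using cm by simp
  also have "\<dots> \<le> colmax j * xv st $ j"
    using inv s j cm unfolding mwu_inv_def by (intro mult_left_mono) auto
  also have "\<dots> \<le> linf_norm (A *\<^sub>v xv st)"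
    using inv mwu_inv_x_nonneg[OF inv M] j
    by (intro colmax_mult_le_linf_norm) (auto simp: mwu_inv_def)
  also have "\<dots> < \<eta>" using run by (simp add: mwu_running_def)
  finally show "(1 + \<epsilon> / \<eta>) ^ (s - 1) \<le> \<eta> * M / \<epsilon>"
    using M eps_pos by (simp add: field_simps)
qed

lemma mwu_inv_weight_step:
  assumes inv: "mwu_inv M Q t K s st" and M: "1 \<le> \<eta> * M / \<epsilon>" and run: "mwu_running A \<epsilon> st"
    and B: "mwu_B A \<epsilon> st \<noteq> {}" and card: "real (card (mwu_B A \<epsilon> st)) \<le> M"
    and Q: "Q = 2 + ln (\<eta> * M / \<epsilon>) / ln (1 + \<epsilon> / \<eta>)"
  shows "mwu_inv M Q (Suc t) K (Suc s) (mwu_step A \<epsilon> st)"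
proof -
  define g where "g = mwu_dir A \<epsilon> st"
  define st' where "st' = mwu_step A \<epsilon> st"
  have "0 < card (mwu_B A \<epsilon> st)"
    using B finite_B by (simp add: card_gt_0_iff)
  then have Mpos: "0 < M" using card by linarith
  have eta: "0 < \<eta>" using eta_pos_of_running[OF run] .
  note nn = mwu_inv_x_nonneg[OF inv Mpos]
  have dimx: "dim_vec (xv st) = N" and dimw: "dim_vec (wv st) = m"
    and w: "\<And>i. i < m \<Longrightarrow> 0 < wv st $ i \<and> wv st $ i \<le> exp ((A *\<^sub>v xv st) $ i)"
    and lam: "lam st = (1 + \<epsilon>) ^ K * lam0"
    and lam_le: "\<And>j. j < N \<Longrightarrow> lam st \<le> (A\<^sup>T *\<^sub>v wv st) $ j"
    and x: "\<And>j. j < N \<Longrightarrow> xv st $ j = 0 \<or> \<epsilon> / (M * colmax j) \<le> xv st $ j"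
    and t: "real t \<le> real K * (Q + 1) + real s"
    and phase: "\<And>j. 0 < s \<Longrightarrow> j \<in> mwu_B A \<epsilon> st \<Longrightarrow>
          \<epsilon> / (M * colmax j) * (1 + \<epsilon> / \<eta>) ^ (s - 1) \<le> xv st $ j"
    using inv unfolding mwu_inv_def by blast+
  have dimg: "dim_vec g = N" by (simp add: g_def dim_dir)
  have g_nn: "0 \<le> g $ j" if "j < N" for j
    unfolding g_def using dir_nonneg[OF dimx nn run that] .
  have Ag_nn: "0 \<le> (A *\<^sub>v g) $ i" if "i < m" for i
    using mult_vec_nonneg[OF that dimg g_nn] .
  have "Min (set\<^sub>v (A\<^sup>T *\<^sub>v wv st)) < (1 + \<epsilon>) * lam st"
    using B B_nonempty_iff by blast
  then have st': "xv st' = xv st + g" "lam st' = lam st"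
      "wv st' = vec m (\<lambda>i. wv st $ i * (1 + (A *\<^sub>v g) $ i))"
    by (simp_all add: st'_def mwu_step_def Let_def g_def)
  have dimw': "dim_vec (wv st') = m" by (simp add: st')
  have x': "xv st' $ j = xv st $ j + g $ j" if "j < N" for j
    using that dimg by (simp add: st')
  have w': "0 < wv st' $ i \<and> wv st' $ i \<le> exp ((A *\<^sub>v xv st') $ i)" if i: "i < m" for i
  proof -
    have "(A *\<^sub>v xv st') $ i = (A *\<^sub>v xv st) $ i + (A *\<^sub>v g) $ i"
      unfolding st' mult_add_distrib_mat_vec[OF A_carrier carrier_vecI[OF dimx] carrier_vecI[OF dimg]]
      using i by simp
    then have e: "exp ((A *\<^sub>v xv st') $ i) = exp ((A *\<^sub>v xv st) $ i) * exp ((A *\<^sub>v g) $ i)"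
      by (simp add: exp_add)
    have "wv st $ i * (1 + (A *\<^sub>v g) $ i) \<le> exp ((A *\<^sub>v xv st') $ i)"
      unfolding e using w[OF i] Ag_nn[OF i] by (intro mult_mono exp_ge_add_one_self) auto
    moreover have "0 < wv st $ i * (1 + (A *\<^sub>v g) $ i)"
      using w[OF i] Ag_nn[OF i] by (intro mult_pos_pos) auto
    ultimately show ?thesis
      using i by (simp add: st' del: index_mult_mat_vec)
  qed
  have w_mono: "wv st $ i \<le> wv st' $ i" if "i < m" for i
    using that w[OF that] Ag_nn[OF that]
      mult_left_mono[of 1 "1 + (A *\<^sub>v g) $ i" "wv st $ i"]
    by (simp add: st' del: index_mult_mat_vec)
  have Aw_mono: "(A\<^sup>T *\<^sub>v wv st) $ j \<le> (A\<^sup>T *\<^sub>v wv st') $ j" if "j < N" for j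
    unfolding transpose_mult_vec_index[OF that dimw] transpose_mult_vec_index[OF that dimw']
    using that w_mono by (intro sum_mono mult_left_mono A_nonneg) auto
  \<comment> \<open>No column enters \<open>B\<close> while \<lambda> is fixed, so the bounds known
    on the old \<open>B\<close> apply to all of the new one.\<close>
  have B_sub: "mwu_B A \<epsilon> st' \<subseteq> mwu_B A \<epsilon> st"
    using Aw_mono unfolding mwu_B_def st'(2) by (auto simp del: index_mult_mat_vec intro: le_less_trans)
  \<comment> \<open>A zero coordinate can become positive only in the \<open>B0\<close> branch,
    because rescaling keeps it at zero.\<close>
  have x_floor: "xv st' $ j = 0 \<or> \<epsilon> / (M * colmax j) \<le> xv st' $ j" if j: "j < N" for j
  proof (cases "\<epsilon> / (M * colmax j) \<le> xv st $ j")
    case True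
    then show ?thesis using g_nn[OF j] x'[OF j] by simp
  next
    case False
    then have 0: "xv st $ j = 0" using x[OF j] by blast
    show ?thesis
    proof (cases "mwu_B0 A \<epsilon> st = {}")
      case True
      then have "j \<notin> mwu_B A \<epsilon> st" using 0 by (auto simp: mwu_B0_def)
      then have "g $ j = 0"
        using True j by (simp add: g_def mwu_dir_def mwu_scale_dir_def)
      then show ?thesis using 0 x'[OF j] by simp
    next
      case B0: False
      show ?thesis
      proof (cases "j \<in> mwu_B0 A \<epsilon> st")
        case True
        then show ?thesis
          using dir_ge_of_B0[OF True card] 0 x'[OF j] by (simp add: g_def)
      next
        case False
        then have "g $ j = 0"
          using B0 j by (simp add: g_def mwu_dir_def mwu_init_dir_def)
        then show ?thesis using 0 x'[OF j] by simp
      qed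
    qed
  qed
  have phase': "\<epsilon> / (M * colmax j) * (1 + \<epsilon> / \<eta>) ^ s \<le> xv st' $ j"
    if "j \<in> mwu_B A \<epsilon> st'" for j
  proof -
    have jB: "j \<in> mwu_B A \<epsilon> st" and j: "j < N"
      using that B_sub by (auto simp: mwu_B_def)
    show ?thesis
    \<comment> \<open>The first iteration of a phase need only make \<open>x\<close> nonzero on
      \<open>B\<close>; \<open>x_floor\<close> then gives the bound with exponent 0.\<close>
    proof (cases "s = 0")
      case True
      have "xv st' $ j \<noteq> 0"
      proof (cases "xv st $ j = 0")
        case 0: True
        then have "j \<in> mwu_B0 A \<epsilon> st" using jB by (simp add: mwu_B0_def)
        from dir_ge_of_B0[OF this card] have "\<epsilon> / (M * colmax j) \<le> g $ j"
          by (simp add: g_def)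
        moreover have "0 < \<epsilon> / (M * colmax j)"
          using eps_pos Mpos colmax_pos[OF j] by simp
        ultimately show ?thesis using 0 x'[OF j] by linarith
      next
        case False
        then show ?thesis using nn[OF j] g_nn[OF j] x'[OF j] by linarith
      qed
      then show ?thesis using x_floor[OF j] True by simp
    next
      case False
      \<comment> \<open>From the second iteration of a phase on, \<open>x\<close> is positive on
        \<open>B\<close>, so the rescaling branch is taken.\<close>
      have "0 < xv st $ k" if "k \<in> mwu_B A \<epsilon> st" for k
      proof -
        have "0 < \<epsilon> / (M * colmax k) * (1 + \<epsilon> / \<eta>) ^ (s - 1)"
          using that eps_pos Mpos eta colmax_pos[of k]
          by (intro mult_pos_pos divide_pos_pos zero_less_power add_pos_pos) (auto simp: mwu_B_def)
        then show ?thesis using phase[OF _ that] False by simp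
      qed
      then have B0: "mwu_B0 A \<epsilon> st = {}" by (fastforce simp: mwu_B0_def)
      have g: "\<epsilon> / \<eta> * xv st $ j \<le> g $ j"
        unfolding g_def by (rule dir_ge_of_B[OF dimx nn B0 run jB])
      have "\<epsilon> / (M * colmax j) * (1 + \<epsilon> / \<eta>) ^ s
          = \<epsilon> / (M * colmax j) * (1 + \<epsilon> / \<eta>) ^ (s - 1) * (1 + \<epsilon> / \<eta>)"
        using False by (cases s) auto
      also have "\<dots> \<le> xv st $ j * (1 + \<epsilon> / \<eta>)"
        using phase[OF _ jB] False eps_pos eta by (intro mult_right_mono) auto
      also have "\<dots> \<le> xv st' $ j"
        using g x'[OF j] by (simp add: algebra_simps)
      finally show ?thesis .
    qed
  qed
  \<comment> \<open>The 2 in \<open>Q\<close> is one for the first iteration of the phase, which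
    only sets the floor, and one for the present iteration. At \<open>s = 0\<close> nonnegativity of
    the logarithm suffices, which is what \<open>M\<close> provides.\<close>
  have s': "real (Suc s) \<le> Q"
  proof (cases "s = 0")
    case True
    have "0 \<le> ln (\<eta> * M / \<epsilon>) / ln (1 + \<epsilon> / \<eta>)"
      using M eps_pos eta by (intro divide_nonneg_nonneg ln_ge_zero) auto
    then show ?thesis using True Q by simp
  next
    case False
    then show ?thesis
      using phase_length_bound[OF inv Mpos run B] Q by (simp add: of_nat_diff)
  qed
  have "mwu_inv M Q (Suc t) K (Suc s) st'"
    unfolding mwu_inv_def
  proof (intro conjI allI impI ballI)
    show "dim_vec (xv st') = N" by (simp add: st' dimg)
    show "lam st' = (1 + \<epsilon>) ^ K * lam0" by (simp add: st' lam)
    show "lam st' \<le> (A\<^sup>T *\<^sub>v wv st') $ j" if "j < N" for j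
      using lam_le[OF that] Aw_mono[OF that] unfolding st'(2) by (rule order.trans)
    show "real (Suc t) \<le> real K * (Q + 1) + real (Suc s)" using t by simp
  qed (use dimw' w' x_floor s' phase' in \<open>auto simp del: index_mult_mat_vec of_nat_Suc\<close>)
  then show ?thesis by (simp add: st'_def)
qed

section \<open>Counting phases and iterations\<close>

lemma phase_count_bound:
  assumes inv: "mwu_inv M Q t K s st" and run: "mwu_running A \<epsilon> st"
  shows "real K \<le> \<eta> / ln (1 + \<epsilon>)"
proof -
  obtain j where j: "j < N" "lam0 = (A\<^sup>T *\<^sub>v ones m) $ j"
    using Min_transpose_mult_attained lam0_eq by metis
  have dimw: "dim_vec (wv st) = m" using inv by (simp add: mwu_inv_def)
  have w: "wv st $ i \<le> exp \<eta>" if i: "i < m" for i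
  proof -
    have "(A *\<^sub>v xv st) $ i \<le> linf_norm (A *\<^sub>v xv st)"
      using i by (intro order.trans[OF abs_ge_self abs_index_le_linf_norm]) simp
    also have "\<dots> < \<eta>" using run by (simp add: mwu_running_def)
    finally have "exp ((A *\<^sub>v xv st) $ i) \<le> exp \<eta>" by simp
    moreover have "wv st $ i \<le> exp ((A *\<^sub>v xv st) $ i)"
      using inv i unfolding mwu_inv_def by blast
    ultimately show ?thesis by (rule order.trans[rotated])
  qed
  have "(1 + \<epsilon>) ^ K * lam0 \<le> (A\<^sup>T *\<^sub>v wv st) $ j"
    using inv j(1) unfolding mwu_inv_def by metis
  also have "\<dots> = (\<Sum>i<m. A $$ (i, j) * wv st $ i)"
    by (rule transpose_mult_vec_index[OF j(1) dimw])
  also have "\<dots> \<le> (\<Sum>i<m. A $$ (i, j) * exp \<eta>)"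
    using j(1) w by (intro sum_mono mult_left_mono A_nonneg) auto
  also have "\<dots> = exp \<eta> * lam0"
    unfolding j(2) using j(1)
    by (subst transpose_mult_vec_index) (auto simp: ones_def sum_distrib_left mult.commute)
  finally have "(1 + \<epsilon>) ^ K \<le> exp \<eta>"
    using lam0_pos by simp
  then show ?thesis
    using exponent_le_ln_quotient[of "1 + \<epsilon>" K "exp \<eta>"] eps_pos by simp
qed

text \<open>There are at most \<open>K + 1\<close> phases, the last possibly unfinished, each of at
  most \<open>Q + 1\<close> iterations. \<open>M\<close> is left free because termination and the
  final bound instantiate it differently.\<close>

lemma iteration_bound:
  assumes run: "\<And>t. t < T \<Longrightarrow> mwu_running A \<epsilon> (mwu_at A \<epsilon> t)"
    and card: "\<And>t. t < T \<Longrightarrow> real (card (mwu_B A \<epsilon> (mwu_at A \<epsilon> t))) \<le> M"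
    and M: "1 \<le> \<eta> * M / \<epsilon>" and T: "0 < T"
  shows "real T \<le> (\<eta> / ln (1 + \<epsilon>) + 1) * (3 + ln (\<eta> * M / \<epsilon>) / ln (1 + \<epsilon> / \<eta>))"
proof -
  define Q where "Q = 2 + ln (\<eta> * M / \<epsilon>) / ln (1 + \<epsilon> / \<eta>)"
  have eta: "0 < \<eta>" using eta_pos_of_running[OF run[OF T]] .
  have "0 \<le> ln (\<eta> * M / \<epsilon>) / ln (1 + \<epsilon> / \<eta>)"
    using M eps_pos eta by (intro divide_nonneg_nonneg ln_ge_zero) auto
  then have Q: "0 \<le> Q" by (simp add: Q_def)
  have "\<exists>K s. mwu_inv M Q t K s (mwu_at A \<epsilon> t)" if "t < T" for t
    using that
  proof (induction t)
    case 0
    then show ?case using mwu_inv_init[OF Q] by (auto simp: mwu_at_def)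
  next
    case (Suc t)
    then obtain K s where inv: "mwu_inv M Q t K s (mwu_at A \<epsilon> t)" by auto
    have step: "mwu_at A \<epsilon> (Suc t) = mwu_step A \<epsilon> (mwu_at A \<epsilon> t)"
      by (simp add: mwu_at_def)
    have t: "t < T" using Suc.prems by simp
    show ?case
      unfolding step
      using mwu_inv_lambda_step[OF inv] mwu_inv_weight_step[OF inv M run[OF t] _ card[OF t] Q_def]
      by blast
  qed
  \<comment> \<open>\<open>T - 1\<close> is the last index at which the loop is known to run, as
    \<open>phase_count_bound\<close> demands.\<close>
  from this[of "T - 1"] obtain K s where inv: "mwu_inv M Q (T - 1) K s (mwu_at A \<epsilon> (T - 1))"
    using T by auto
  have "real K \<le> \<eta> / ln (1 + \<epsilon>)"
    using phase_count_bound[OF inv run] T by simp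
  moreover have "real (T - 1) \<le> real K * (Q + 1) + Q"
    using inv by (simp add: mwu_inv_def)
  then have "real T \<le> (real K + 1) * (Q + 1)"
    using T by (simp add: of_nat_diff algebra_simps)
  ultimately have "real T \<le> (\<eta> / ln (1 + \<epsilon>) + 1) * (Q + 1)"
    using Q by (smt (verit) mult_right_mono)
  then show ?thesis by (simp add: Q_def)
qed

section \<open>Termination\<close>

text \<open>Since \<open>mwu_max_B\<close> refers to \<open>T\<close>, a first bound must come from
  the number of columns: an endless run would satisfy \<open>iteration_bound\<close> for every
  \<open>T\<close> with a fixed right-hand side.\<close>

lemma mwu_terminates: "\<exists>T. mwu_iterations A \<epsilon> T"
proof -
  have "\<exists>t. \<not> mwu_running A \<epsilon> (mwu_at A \<epsilon> t)"
  proof (rule ccontr)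
    assume "\<not> ?thesis"
    then have run: "\<And>t. mwu_running A \<epsilon> (mwu_at A \<epsilon> t)" by blast
    have eta: "0 < \<eta>" using eta_pos_of_running[OF run] .
    \<comment> \<open>The second argument of \<open>max\<close> secures
      \<open>1 \<le> \<eta> * M / \<epsilon>\<close>.\<close>
    define M where "M = max (real N) (\<epsilon> / \<eta>)"
    define b where "b = (\<eta> / ln (1 + \<epsilon>) + 1) * (3 + ln (\<eta> * M / \<epsilon>) / ln (1 + \<epsilon> / \<eta>))"
    have "\<epsilon> / \<eta> \<le> M" by (simp add: M_def)
    then have M: "1 \<le> \<eta> * M / \<epsilon>" using eta eps_pos by (simp add: field_simps)
    have card: "real (card (mwu_B A \<epsilon> (mwu_at A \<epsilon> t))) \<le> M" for t
      using card_B_le[of "mwu_at A \<epsilon> t"] by (simp add: M_def max_def)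
    have "real (Suc T) \<le> b" for T
      unfolding b_def by (rule iteration_bound[OF run card M]) auto
    then show False
      using reals_Archimedean2[of b] by (metis less_le_not_le lessI less_imp_of_nat_less order.trans)
  qed
  \<comment> \<open>The required \<open>T\<close> is the least index at which the loop condition
    fails.\<close>
  then show ?thesis
    unfolding mwu_iterations_def by (subst (asm) exists_least_iff) auto
qed

section \<open>Asymptotic form of the bound\<close>

lemma iteration_bound_asymptotic:
  fixes E c :: real
  defines "a \<equiv> E\<^sup>2 / ln 2"
  assumes c: "1 < c" and iter: "mwu_iterations A \<epsilon> T" and eps: "\<epsilon> \<le> E"
    and large: "c \<le> \<eta> * real (mwu_max_B A \<epsilon> T) / \<epsilon>"
  shows "real T \<le> (1 + E + a) * (1 + a + 3 * a / ln c) *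
    ((ln (real m))\<^sup>2 * ln (\<eta> * real (mwu_max_B A \<epsilon> T) / \<epsilon>) / \<epsilon> ^ 4)"
proof -
  define M where "M = real (mwu_max_B A \<epsilon> T)"
  define L where "L = ln (\<eta> * M / \<epsilon>)"
  \<comment> \<open>The target is a constant times \<open>p\<^sup>2 * L\<close>, so the two factors
    of \<open>iteration_bound\<close> are compared with \<open>p\<close> and
    \<open>p * L\<close>.\<close>
  define p where "p = \<eta> / \<epsilon>"
  \<comment> \<open>For \<open>m = 1\<close> one has \<open>\<eta> = 0\<close>, and the quotient in
    \<open>large\<close> would be 0.\<close>
  have m2: "2 \<le> m"
  proof (rule ccontr)
    assume "\<not> ?thesis"
    then have "m = 1" using m_pos by simp
    then show False using large c by (simp add: mwu_eta_def)
  qed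
  have ln2: "0 < ln (2::real)" by simp
  have a: "0 \<le> a" using ln2 by (simp add: a_def)
  have Lc: "0 < ln c" "ln c \<le> L"
    using c large by (auto simp: L_def M_def)
  have p_eq: "p = ln (real m) / \<epsilon>\<^sup>2"
    by (simp add: p_def mwu_eta_def power2_eq_square)
  have ppos: "0 < p" using m2 eps_pos unfolding p_eq by simp
  have eta: "0 < \<eta>" using ppos eps_pos by (simp add: p_def zero_less_divide_iff)
  \<comment> \<open>The choice of \<open>a\<close> gives \<open>1 \<le> a * p\<close> for all
    \<open>\<epsilon> \<le> E\<close> and \<open>m \<ge> 2\<close>; this absorbs additive constants
    into multiples of \<open>p\<close>.\<close>
  have "\<epsilon>\<^sup>2 * ln 2 \<le> E\<^sup>2 * ln (real m)"
    using eps eps_pos m2 ln2 by (intro mult_mono power_mono) auto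
  then have ap: "1 \<le> a * p"
    using eps_pos ln2 by (simp add: a_def p_eq field_simps)
  have fin: "card (mwu_B A \<epsilon> (mwu_at A \<epsilon> t)) \<le> mwu_max_B A \<epsilon> T" if "t < T" for t
    unfolding mwu_max_B_def using that by (intro Max_ge) auto
  have "\<not> mwu_running A \<epsilon> (mwu_at A \<epsilon> T)" "\<And>t. t < T \<Longrightarrow> mwu_running A \<epsilon> (mwu_at A \<epsilon> t)"
    using iter by (auto simp: mwu_iterations_def)
  \<comment> \<open>Excludes \<open>T = 0\<close>, where \<open>mwu_max_B\<close> would be a maximum
    over the empty set.\<close>
  moreover have "mwu_running A \<epsilon> (mwu_at A \<epsilon> 0)"
  proof -
    have "linf_norm (A *\<^sub>v 0\<^sub>v N) \<le> 0"
    proof (rule linf_norm_le)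
      fix i assume "i < dim_vec (A *\<^sub>v 0\<^sub>v N)"
      then show "\<bar>(A *\<^sub>v 0\<^sub>v N) $ i\<bar> \<le> 0"
        by (subst mult_vec_index) auto
    qed (simp add: m_pos)
    then show ?thesis
      using eta by (simp add: mwu_running_def mwu_at_def mwu_init_def Let_def)
  qed
  ultimately have "real T \<le> (\<eta> / ln (1 + \<epsilon>) + 1) * (3 + L / ln (1 + \<epsilon> / \<eta>))"
    unfolding L_def M_def using fin large c
    by (intro iteration_bound) (auto intro: gr0I)
  also have "\<dots> \<le> (p * (1 + E + a)) * (p * L * (1 + a + 3 * a / ln c))"
  proof (rule mult_mono)
    have "\<eta> / ln (1 + \<epsilon>) \<le> \<eta> * (1 + 1 / \<epsilon>)"
      using mult_left_mono[OF inverse_ln_one_plus_le[OF eps_pos], of \<eta>] eta by simp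
    also have "\<dots> = p * (1 + \<epsilon>)" using eps_pos by (simp add: p_def field_simps)
    also have "\<dots> \<le> p * (1 + E)" using ppos eps by simp
    finally show "\<eta> / ln (1 + \<epsilon>) + 1 \<le> p * (1 + E + a)"
      using ap by (simp add: algebra_simps)
    have "1 / ln (1 + \<epsilon> / \<eta>) \<le> 1 + p"
      using inverse_ln_one_plus_le[of "\<epsilon> / \<eta>"] eps_pos eta by (simp add: p_def)
    also have "\<dots> \<le> p * (1 + a)" using ap by (simp add: algebra_simps)
    finally have "L * (1 / ln (1 + \<epsilon> / \<eta>)) \<le> L * (p * (1 + a))"
      using Lc by (intro mult_left_mono) auto
    \<comment> \<open>Absorbs the constant 3 into \<open>p * L\<close>; this is the origin of
      \<open>3 * a / ln c\<close>.\<close>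
    moreover have "1 * 1 \<le> (a * p) * (L / ln c)"
      using ap Lc by (intro mult_mono) auto
    moreover have "p * L * (1 + a + 3 * a / ln c) = L * (p * (1 + a)) + 3 * ((a * p) * (L / ln c))"
      by (simp add: algebra_simps)
    ultimately show "3 + L / ln (1 + \<epsilon> / \<eta>) \<le> p * L * (1 + a + 3 * a / ln c)"
      by simp
    show "0 \<le> p * (1 + E + a)" using ppos a eps eps_pos by simp
    show "0 \<le> 3 + L / ln (1 + \<epsilon> / \<eta>)" using Lc eps_pos eta by simp
  qed
  also have "\<dots> = (1 + E + a) * (1 + a + 3 * a / ln c) * (p\<^sup>2 * L)"
    by (simp add: power2_eq_square)
  also have "p\<^sup>2 * L = (ln (real m))\<^sup>2 * L / \<epsilon> ^ 4"
    by (simp add: p_eq power_divide flip: power_mult)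
  finally show ?thesis by (simp add: L_def M_def)
qed

end

text \<open>The O-bound is made precise by a constant depending only on \<open>E\<close> and
  \<open>c\<close>: \<epsilon> stays below \<open>E\<close>, and \<open>c\<close> keeps the
  logarithm away from 0. Termination is asserted for every positive \<epsilon>.\<close>

theorem theorem3p5:
  fixes E c :: real
  assumes "E > 0" and "c > 1"
  shows "\<exists>C>0. \<forall>(m::nat) (N::nat) (A::real mat) (\<epsilon>::real).
    m > 0 \<longrightarrow> N > 0 \<longrightarrow> A \<in> carrier_mat m N \<longrightarrow>
    (\<forall>i<m. \<forall>j<N. A $$ (i, j) \<ge> 0) \<longrightarrow> (\<forall>j<N. col A j \<noteq> 0\<^sub>v m) \<longrightarrow>
    \<epsilon> > 0 \<longrightarrow>
    (\<exists>T. mwu_iterations A \<epsilon> T \<and>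
      (\<epsilon> \<le> E \<longrightarrow> mwu_eta A \<epsilon> * real (mwu_max_B A \<epsilon> T) / \<epsilon> \<ge> c \<longrightarrow>
        real T \<le> C * ((ln (real m))\<^sup>2 *
          ln (mwu_eta A \<epsilon> * real (mwu_max_B A \<epsilon> T) / \<epsilon>) / \<epsilon> ^ 4)))"
proof -
  define a where "a = E\<^sup>2 / ln 2"
  define C where "C = (1 + E + a) * (1 + a + 3 * a / ln c)"
  have "0 \<le> a" by (simp add: a_def)
  then have "0 < C"
    unfolding C_def using assms by (intro mult_pos_pos add_pos_nonneg) auto
  moreover have "\<exists>T. mwu_iterations A \<epsilon> T \<and>
      (\<epsilon> \<le> E \<longrightarrow> mwu_eta A \<epsilon> * real (mwu_max_B A \<epsilon> T) / \<epsilon> \<ge> c \<longrightarrow>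
        real T \<le> C * ((ln (real m))\<^sup>2 *
          ln (mwu_eta A \<epsilon> * real (mwu_max_B A \<epsilon> T) / \<epsilon>) / \<epsilon> ^ 4))"
    if "m > 0" "N > 0" "A \<in> carrier_mat m N" "\<forall>i<m. \<forall>j<N. A $$ (i, j) \<ge> 0"
      "\<forall>j<N. col A j \<noteq> 0\<^sub>v m" "\<epsilon> > 0" for m N A \<epsilon>
  proof -
    interpret mwu m N A \<epsilon>
      using that by unfold_locales auto
    show ?thesis
      using mwu_terminates iteration_bound_asymptotic[OF assms(2)] unfolding C_def a_def by blast
  qed
  ultimately show ?thesis by blast
qed

end
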